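(* For all positive integers $n, s$ with $s \geq 4$, $$\sum_{d\mid n} \frac{1}{d}\left((-1)^d\, \delta_1\!\left(\frac{n}{d},s-2\right) + \delta_2\!\left(\frac{n}{d},s-2\right)\right) = \sum_{j=1}^{n} \frac{(-1)^j}{j} \binom{n}{j}\, t_{s,j}(n),$$ where the sum on the left runs over all positive divisors $d$ of $n$.
   Context: For an integer $s\ge 3$ and $m\in\mathbb{Z}$, the generalized $m$-th $s$-gonal number is $F_s(m) := \frac{(s-2)m^2-(s-4)m}{2}$; these numbers are called $s$-gonal numbers. For $j\ge 1$, $t_{s,j}(n)$ denotes the number of representations of $n$ as a sum of $j$ $s$-gonal numbers, i.e. the number of ordered $j$-tuples $(m_1,\dots,m_j)\in\mathbb{Z}^j$ with $F_s(m_1)+\cdots+F_s(m_j)=n$; equivalently, the coefficient of $q^n$ in $G_s(q)^j$, where $G_s(q)=\sum_{m=-\infty}^{\infty} q^{F_s(m)}$. For integers $m\ge 1$ and $v\ge 2$, define $$\delta_1(m,v)=\begin{cases}2, & \text{if } v=2 \text{ and } m\equiv 1 \pmod 2,\\ 1, & \text{if } v\ge 3 \text{ and } m\equiv 1 \text{ or } v-1 \pmod v,\\ 0, & \text{otherwise,}\end{cases}\qquad \delta_2(m,v)=\begin{cases}1, & \text{if } m\equiv 0 \pmod v,\\ 0, & \text{otherwise.}\end{cases}$$ *)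

theory Defs
  imports Complex_Main "HOL-Number_Theory.Cong"
begin

definition gonal :: "nat \<Rightarrow> int \<Rightarrow> int" where
  "gonal s m = ((int s - 2) * m\<^sup>2 - (int s - 4) * m) div 2"

(* The integer division in the definition is exact. *)
lemma two_times_gonal: "2 * gonal s m = (int s - 2) * m\<^sup>2 - (int s - 4) * m"
proof -
  have "even ((int s - 2) * m\<^sup>2 - (int s - 4) * m)"
    by (cases "even m") auto
  then show ?thesis
    by (simp add: gonal_def)
qed

(* Ordered j-tuples of integers are lists of length j. For s \<ge> 3 the set is finite, so that
   card is the true number of representations. *)
definition gonal_reps :: "nat \<Rightarrow> nat \<Rightarrow> nat \<Rightarrow> nat" where
  "gonal_reps s j n =
     card {ms :: int list. length ms = j \<and> (\<Sum>m\<leftarrow>ms. gonal s m) = int n}"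

lemma abs_le_gonal:
  assumes "s \<ge> 3"
  shows "\<bar>m\<bar> \<le> gonal s m + 1" and "0 \<le> gonal s m"
proof -
  define a where "a = int s - 3"
  have a: "a \<ge> 0" using assms by (simp add: a_def)
  have tri: "0 \<le> m * (m - 1)" 
    by (cases "m \<le> 0") (auto simp: mult_nonpos_nonpos)
  have tri': "0 \<le> m * (m + 1)"
    by (cases "m \<ge> 0") (auto intro: mult_nonpos_nonpos)
  have eq: "2 * gonal s m = a * (m * (m - 1)) + m * (m + 1)"
    unfolding two_times_gonal a_def by (simp add: algebra_simps power2_eq_square)
  have a0: "0 \<le> a * (m * (m - 1))" using a tri by simp
  show "0 \<le> gonal s m" using eq a0 tri' by linarith
  have "2 * \<bar>m\<bar> \<le> m * (m + 1) + 2"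
  proof (cases "m \<ge> 0")
    case True
    then show ?thesis using tri by (simp add: algebra_simps)
  next
    case False
    have "0 \<le> (m + 1) * (m + 2)"
      using False by (cases "m = -1") (auto intro: mult_nonpos_nonpos)
    then show ?thesis using False by (simp add: algebra_simps)
  qed
  then show "\<bar>m\<bar> \<le> gonal s m + 1" using eq a0 by linarith
qed

lemma finite_gonal_reps:
  assumes "s \<ge> 3"
  shows "finite {ms :: int list. length ms = j \<and> (\<Sum>m\<leftarrow>ms. gonal s m) = int n}"
proof (rule finite_subset)
  show "{ms. length ms = j \<and> (\<Sum>m\<leftarrow>ms. gonal s m) = int n}
          \<subseteq> {ms. set ms \<subseteq> {- (int n + 1)..int n + 1} \<and> length ms = j}"
  proof (intro subsetI CollectI conjI)
    fix ms m
    assume ms: "ms \<in> {ms. length ms = j \<and> (\<Sum>m\<leftarrow>ms. gonal s m) = int n}" and m: "m \<in> set ms"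
    have "gonal s m \<le> (\<Sum>m\<leftarrow>ms. gonal s m)"
      by (rule member_le_sum_list) (use m abs_le_gonal(2)[OF assms] in auto)
    then have "\<bar>m\<bar> \<le> int n + 1"
      using ms abs_le_gonal(1)[OF assms, of m] by simp
    then show "m \<in> {- (int n + 1)..int n + 1}" by auto
  qed auto
  show "finite {ms. set ms \<subseteq> {- (int n + 1)..int n + 1} \<and> length ms = j}"
    by (rule finite_lists_length_eq) simp
qed

definition delta1 :: "nat \<Rightarrow> nat \<Rightarrow> nat" where
  "delta1 m v =
     (if v = 2 \<and> [m = 1] (mod 2) then 2
      else if v \<ge> 3 \<and> ([m = 1] (mod v) \<or> [m = v - 1] (mod v)) then 1
      else 0)"

definition delta2 :: "nat \<Rightarrow> nat \<Rightarrow> nat" where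
  "delta2 m v = (if [m = 0] (mod v) then 1 else 0)"

end

theory Submission
  imports Defs "HOL-Computational_Algebra.Formal_Power_Series"
begin

text \<open>
  Let \<open>v = s - 2\<close> and let \<open>G\<close> be the generating function \<open>\<Sum>m. q ^ F\<^sub>s m\<close> over all integers \<open>m\<close>.
  Both sides of the identity are the coefficient of \<open>q ^ n\<close> in \<open>- log G\<close>.

  The right-hand side arises from \<open>log G = \<Sum>k\<ge>1. (-1) ^ (k - 1) / k * (G - 1) ^ k\<close>. Only the terms with
  \<open>k \<le> n\<close> contribute to the coefficient of \<open>q ^ n\<close>; expanding \<open>(G - 1) ^ k\<close> in powers of \<open>G\<close> and using
  the hockey-stick sum \<open>\<Sum>k = 1..n. (k choose j) / k = (n choose j) / j\<close> for \<open>j \<ge> 1\<close> turns them into a combination of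
  the coefficients of \<open>G ^ j\<close>, which count representations by \<open>j\<close> polygonal numbers
  (\<open>fps_log_nth_powers\<close>, \<open>gonal_fps_power_nth\<close>).

  The left-hand side arises from the Jacobi triple product, which factors \<open>G\<close> as
  \<open>\<Prod>i\<ge>0. (1 - q ^ (v * i + v)) * (1 + q ^ (v * i + 1)) * (1 + q ^ (v * i + v - 1))\<close>.
  The logarithm of a factor \<open>1 + c * q ^ a\<close> is \<open>- (\<Sum>d\<ge>1. (- c) ^ d / d * q ^ (a * d))\<close>, so the coefficient of
  \<open>q ^ n\<close> in \<open>- log G\<close> is a sum over the divisors \<open>d\<close> of \<open>n\<close>, where \<open>d\<close> is weighted by the number of
  factors with exponent \<open>n / d\<close>. The factors with a plus sign are counted by \<^const>\<open>delta1\<close>, the others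
  by \<^const>\<open>delta2\<close>; for \<open>v = 2\<close> the two families with a plus sign coincide, which is why \<^const>\<open>delta1\<close> then
  takes the value 2.

  Since one coefficient depends only on a truncation of \<open>G\<close>, no infinite product has to be formed.
  The triple product is used in a finite version (\<open>finite_triple_product\<close>), a substitution instance of the
  \<open>q\<close>-binomial theorem, whose terms are Gaussian binomial coefficients times powers \<open>q ^ F\<^sub>s m\<close>. Multiplied by
  the first \<open>N\<close> factors with a minus sign, the coefficient belonging to \<open>m\<close> is 1 plus terms of order at
  least \<open>v * (N - \<bar>m\<bar> + 1)\<close>; together with \<open>q ^ F\<^sub>s m\<close> these are invisible below degree \<open>N\<close>
  (\<open>gonal_fps_nth_triple_product\<close>).
\<close>

unbundle fps_syntax

section \<open>The logarithm of a formal power series\<close>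

definition fps_log :: "real fps \<Rightarrow> real fps" where
  "fps_log f = fps_ln 1 oo (f - 1)"

lemma fps_log_nth_0: "fps_log f $ 0 = 0"
  by (simp add: fps_log_def fps_compose_nth fps_ln_def)

lemma fps_deriv_fps_log:
  assumes "f $ 0 = 1"
  shows "fps_deriv (fps_log f) = inverse f * fps_deriv f"
proof -
  have f: "(f - 1) $ 0 = 0" using assms by simp
  have "inverse (1 + fps_X) oo (f - 1) = inverse ((1 + fps_X) oo (f - 1))"
    by (rule fps_inverse_compose[OF f]) simp
  also have "(1 + fps_X) oo (f - 1) = f"
    using f by (simp add: fps_compose_add_distrib)
  finally show ?thesis
    by (simp add: fps_log_def fps_compose_deriv[OF f] fps_ln_deriv)
qed

text \<open>
  The formal logarithmic derivative is additive, and a series without constant term is determined by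
  its derivative.
\<close>

lemma fps_log_mult:
  assumes f: "f $ 0 = 1" and g: "g $ 0 = 1"
  shows "fps_log (f * g) = fps_log f + fps_log g"
proof -
  have "inverse f * f = 1" "inverse g * g = 1"
    using f g by (simp_all add: inverse_mult_eq_1)
  moreover have "fps_deriv (fps_log (f * g)) = (inverse f * inverse g) * fps_deriv (f * g)"
    using f g by (simp only: fps_deriv_fps_log fps_inverse_mult fps_mult_nth_0 mult_1)
  moreover have "(inverse f * inverse g) * fps_deriv (f * g)
      = (inverse f * f) * (inverse g * fps_deriv g) + (inverse g * g) * (inverse f * fps_deriv f)"
    by (simp add: algebra_simps)
  ultimately have "fps_deriv (fps_log (f * g)) = fps_deriv (fps_log f + fps_log g)"
    using f g by (simp only: fps_deriv_fps_log fps_deriv_add mult_1 add.commute)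
  then show ?thesis
    unfolding fps_deriv_eq_iff by (simp add: fps_log_nth_0)
qed

lemma fps_prod_nth_0: "(\<Prod>i\<in>A. f i) $ 0 = (\<Prod>i\<in>A. f i $ 0)"
  for f :: "'i \<Rightarrow> 'a::comm_ring_1 fps"
  by (induction A rule: infinite_finite_induct) auto

lemma fps_log_prod:
  assumes "finite A" and "\<And>i. i \<in> A \<Longrightarrow> f i $ 0 = 1"
  shows "fps_log (\<Prod>i\<in>A. f i) = (\<Sum>i\<in>A. fps_log (f i))"
  using assms
proof (induction A)
  case empty
  then show ?case by (simp add: fps_log_def fps_ln_def)
next
  case (insert x F)
  then show ?case by (simp add: fps_log_mult fps_prod_nth_0)
qed

lemma fps_log_nth_cong:
  assumes "\<And>m. m \<le> n \<Longrightarrow> f $ m = g $ m"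
  shows "fps_log f $ n = fps_log g $ n"
proof -
  have "(f - 1) ^ k $ m = (g - 1) ^ k $ m" if "m \<le> n" for k m
    using that
  proof (induction k arbitrary: m)
    case (Suc k)
    then show ?case using assms by (auto simp: fps_mult_nth intro!: sum.cong)
  qed simp
  then show ?thesis by (simp add: fps_log_def fps_compose_nth)
qed

text \<open>
  Substituting a monomial into the logarithm series only spreads out its coefficients, so the
  result has nonzero coefficients only at multiples of \<open>a\<close>.
\<close>

lemma fps_log_binomial_nth:
  assumes "a \<ge> 1" and "n \<ge> 1"
  shows "fps_log (1 + fps_const c * fps_X ^ a) $ n
       = (if a dvd n then - ((- c) ^ (n div a)) / real (n div a) else 0)"
proof -
  have "fps_log (1 + fps_const c * fps_X ^ a) $ n
      = (\<Sum>k = 0..n. fps_ln 1 $ k * (if n = a * k then c ^ k else 0))"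
    by (simp add: fps_log_def fps_compose_nth power_mult_distrib fps_const_power
        flip: power_mult cong: if_cong) (intro sum.cong, auto)
  also have "\<dots> = (\<Sum>k \<in> {0..n}. if k = n div a \<and> a dvd n then fps_ln 1 $ k * c ^ k else 0)"
    using assms by (intro sum.cong) auto
  also have "\<dots> = (if a dvd n then fps_ln 1 $ (n div a) * c ^ (n div a) else 0)"
    by (auto simp: sum.delta')
  also have "\<dots> = (if a dvd n then - ((- c) ^ (n div a)) / real (n div a) else 0)"
  proof (cases "a dvd n")
    case True
    then have "n div a \<noteq> 0" using assms by (auto elim!: dvdE)
    then obtain d where "n div a = Suc d" by (cases "n div a") auto
    then show ?thesis
      by (simp add: fps_ln_def power_minus[of c])
  qed simp
  finally show ?thesis .
qed

text \<open>
  Expanding \<open>(f - 1) ^ k\<close> in the first \<open>n\<close> terms of the logarithm series and collecting the powers of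
  \<open>f\<close> makes \<open>f ^ j $ n\<close> appear with the factor \<open>\<Sum>k = 1..n. (k choose j) / k\<close>, which collapses to
  \<open>(n choose j) / j\<close> for \<open>j \<ge> 1\<close> because \<open>(k choose j) / k = (k - 1 choose j - 1) / j\<close>. The power \<open>f ^ 0\<close>
  has no coefficient at \<open>n \<ge> 1\<close>.
\<close>

lemma fps_log_nth_powers:
  assumes "n \<ge> 1"
  shows "fps_log f $ n = - (\<Sum>j = 1..n. (-1) ^ j / real j * real (n choose j) * (f ^ j $ n))"
proof -
  have pw: "(f - 1) ^ k $ n = (\<Sum>j\<le>n. (-1) ^ (k + j) * real (k choose j) * (f ^ j $ n))"
    if "k \<le> n" for k
  proof -
    have "(f - 1) ^ k = (\<Sum>j\<le>k. of_nat (k choose j) * f ^ j * (-1) ^ (k - j))"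
      using binomial_ring[of f "-1" k] by simp
    also have "\<dots> = (\<Sum>j\<le>k. fps_const ((-1) ^ (k + j) * real (k choose j)) * f ^ j)"
    proof (intro sum.cong refl)
      fix j assume "j \<in> {..k}"
      then have "(-1 :: real) ^ (k - j) = (-1) ^ (k + j)"
        by (auto simp: minus_one_power_iff)
      moreover have "(-1 :: real fps) ^ (k - j) = fps_const ((-1) ^ (k - j))"
        by (simp add: minus_one_power_iff fps_const_neg[symmetric] del: fps_const_neg)
      ultimately show "of_nat (k choose j) * f ^ j * (-1) ^ (k - j)
          = fps_const ((-1) ^ (k + j) * real (k choose j)) * f ^ j"
        by (simp add: fps_of_nat[symmetric] fps_const_mult[symmetric] mult_ac del: fps_const_mult)
    qed
    finally have "(f - 1) ^ k $ n = (\<Sum>j\<le>k. (-1) ^ (k + j) * real (k choose j) * (f ^ j $ n))"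
      by (simp add: fps_sum_nth)
    also have "\<dots> = (\<Sum>j\<le>n. (-1) ^ (k + j) * real (k choose j) * (f ^ j $ n))"
      using that by (intro sum.mono_neutral_left) auto
    finally show ?thesis .
  qed
  have hockey: "(\<Sum>k = 1..n. real (k choose j) / real k) = real (n choose j) / real j"
    if j1: "j \<ge> 1" for j n
  proof (induction n)
    case 0
    then show ?case using j1 by simp
  next
    case (Suc n)
    obtain i where j: "j = Suc i" using j1 by (cases j) auto
    have "real (Suc i) * real (Suc n choose Suc i) = real (Suc n) * real (n choose i)"
      using Suc_times_binomial_eq[of n i] by (metis of_nat_mult mult.commute)
    then have "real (Suc n choose j) / real (Suc n) = real (n choose i) / real j"
      unfolding j by (simp add: field_simps del: of_nat_Suc binomial_Suc_Suc)
    then show ?case using Suc by (simp add: j add_divide_distrib)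
  qed
  have "fps_log f $ n = (\<Sum>k = 0..n. fps_ln 1 $ k * ((f - 1) ^ k $ n))"
    by (simp add: fps_log_def fps_compose_nth)
  also have "\<dots> = (\<Sum>k = 1..n. fps_ln 1 $ k * ((f - 1) ^ k $ n))"
    using assms by (simp add: sum.atLeast_Suc_atMost fps_ln_def)
  also have "\<dots> = (\<Sum>k = 1..n. \<Sum>j\<le>n. - ((-1) ^ j * (f ^ j $ n) * (real (k choose j) / real k)))"
  proof (intro sum.cong refl)
    fix k assume k: "k \<in> {1..n}"
    then obtain i where i: "k = Suc i" by (cases k) auto
    have "fps_ln 1 $ k * (-1) ^ (k + j) = - ((-1) ^ j / real k)" for j
      by (simp add: fps_ln_def i minus_one_power_iff)
    then have *: "fps_ln 1 $ k * ((-1) ^ (k + j) * real (k choose j) * (f ^ j $ n))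
        = - ((-1) ^ j * (f ^ j $ n) * (real (k choose j) / real k))" for j
      by (simp add: mult.assoc[symmetric]) 
    have "(f - 1) ^ k $ n = (\<Sum>j\<le>n. (-1) ^ (k + j) * real (k choose j) * (f ^ j $ n))"
      by (rule pw) (use k in simp)
    then show "fps_ln 1 $ k * ((f - 1) ^ k $ n)
        = (\<Sum>j\<le>n. - ((-1) ^ j * (f ^ j $ n) * (real (k choose j) / real k)))"
      by (simp only: sum_distrib_left *)
  qed
  also have "\<dots> = (\<Sum>j\<le>n. - ((-1) ^ j * (f ^ j $ n) * (\<Sum>k = 1..n. real (k choose j) / real k)))"
    by (subst sum.swap) (simp add: sum_distrib_left sum_negf)
  also have "\<dots> = (\<Sum>j = 1..n. - ((-1) ^ j * (f ^ j $ n) * (\<Sum>k = 1..n. real (k choose j) / real k)))"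
    using assms by (intro sum.mono_neutral_right) (auto simp: Suc_le_eq)
  also have "\<dots> = - (\<Sum>j = 1..n. (-1) ^ j / real j * real (n choose j) * (f ^ j $ n))"
    unfolding sum_negf[symmetric] by (intro sum.cong refl) (simp add: hockey[unfolded One_nat_def])
  finally show ?thesis .
qed

section \<open>Gaussian binomial coefficients\<close>

text \<open>
  This is the \<open>q\<close>-Pochhammer symbol usually written \<open>(Q; Q)\<^sub>n\<close>.
\<close>

definition qpoch :: "'a::comm_ring_1 \<Rightarrow> nat \<Rightarrow> 'a" where
  "qpoch Q n = (\<Prod>i<n. 1 - Q ^ Suc i)"

text \<open>
  Defining the coefficients by a Pascal rule instead of a quotient of \<open>q\<close>-Pochhammer symbols keeps them
  meaningful in every commutative ring. Where the truncated exponent \<open>n - k\<close> is wrong, namely for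
  \<open>k > n\<close>, the coefficient that it multiplies vanishes.
\<close>

fun gauss_binomial :: "'a::comm_ring_1 \<Rightarrow> nat \<Rightarrow> nat \<Rightarrow> 'a" where
  "gauss_binomial Q n 0 = 1"
| "gauss_binomial Q 0 (Suc k) = 0"
| "gauss_binomial Q (Suc n) (Suc k) = gauss_binomial Q n (Suc k) + Q ^ (n - k) * gauss_binomial Q n k"

lemma gauss_binomial_eq_0: "n < k \<Longrightarrow> gauss_binomial Q n k = 0"
  by (induction Q n k rule: gauss_binomial.induct) auto

lemma qpoch_mult_gauss_binomial:
  "k \<le> n \<Longrightarrow> qpoch Q k * qpoch Q (n - k) * gauss_binomial Q n k = qpoch Q n"
proof (induction n arbitrary: k)
  case 0
  then show ?case by (simp add: qpoch_def)
next
  case (Suc n)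
  show ?case
  proof (cases k)
    case 0
    then show ?thesis by (simp add: qpoch_def)
  next
    case (Suc l)
    have l: "l \<le> n" using Suc.prems Suc by simp
    have upper: "qpoch Q (Suc l) * qpoch Q (n - l) * gauss_binomial Q n (Suc l)
        = (1 - Q ^ (n - l)) * qpoch Q n"
    proof (cases "l = n")
      case True
      then show ?thesis by (simp add: gauss_binomial_eq_0)
    next
      case False
      then have "n - l = Suc (n - Suc l)" using l by simp
      then have "qpoch Q (n - l) = qpoch Q (n - Suc l) * (1 - Q ^ (n - l))"
        by (simp add: qpoch_def)
      then have "qpoch Q (Suc l) * qpoch Q (n - l) * gauss_binomial Q n (Suc l)
          = (1 - Q ^ (n - l)) * (qpoch Q (Suc l) * qpoch Q (n - Suc l) * gauss_binomial Q n (Suc l))"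
        by (simp only: mult_ac)
      then show ?thesis
        using Suc.IH[of "Suc l"] False l by simp
    qed
    have "qpoch Q (Suc l) = qpoch Q l * (1 - Q ^ Suc l)"
      by (simp add: qpoch_def)
    then have lower: "qpoch Q (Suc l) * qpoch Q (n - l) * gauss_binomial Q n l
        = (1 - Q ^ Suc l) * qpoch Q n"
      using Suc.IH[OF l] by (metis mult.assoc mult.commute)
    have "qpoch Q k * qpoch Q (Suc n - k) * gauss_binomial Q (Suc n) k
        = qpoch Q (Suc l) * qpoch Q (n - l) * gauss_binomial Q n (Suc l)
          + Q ^ (n - l) * (qpoch Q (Suc l) * qpoch Q (n - l) * gauss_binomial Q n l)"
      by (simp add: Suc algebra_simps)
    also have "\<dots> = (1 - Q ^ (n - l)) * qpoch Q n + Q ^ (n - l) * ((1 - Q ^ Suc l) * qpoch Q n)"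
      by (simp only: upper lower)
    also have "\<dots> = (1 - Q ^ (n - l) * Q ^ Suc l) * qpoch Q n"
    proof -
      have "(1 - x) * z + x * ((1 - y) * z) = (1 - x * y) * z" for x y z :: 'a
        by (simp add: algebra_simps)
      then show ?thesis .
    qed
    also have "Q ^ (n - l) * Q ^ Suc l = Q ^ Suc n"
      using l by (simp only: power_add[symmetric]) simp
    finally show ?thesis by (simp add: qpoch_def mult.commute)
  qed
qed

text \<open>
  Multiplying by one more factor \<open>x + y * Q ^ n\<close> produces exactly the Pascal rule, since
  \<open>Q ^ n = Q ^ (n - k) * Q ^ k\<close> and the second power is what \<open>Q ^ (k choose 2)\<close> lacks to become
  \<open>Q ^ (Suc k choose 2)\<close>.
\<close>

lemma q_binomial_theorem:
  "(\<Prod>i<n. x + y * Q ^ i)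
     = (\<Sum>k\<le>n. gauss_binomial Q n k * Q ^ (k choose 2) * y ^ k * x ^ (n - k))"
proof (induction n)
  case 0
  then show ?case by (simp add: numeral_2_eq_2)
next
  case (Suc n)
  let ?c = "\<lambda>k. Q ^ (k choose 2) * y ^ k"
  have choose2: "Suc k choose 2 = k + (k choose 2)" for k
    by (simp add: numeral_2_eq_2)
  have "(\<Prod>i<Suc n. x + y * Q ^ i)
      = (\<Sum>k\<le>n. gauss_binomial Q n k * ?c k * x ^ (n - k)) * (x + y * Q ^ n)"
    by (simp add: Suc mult.assoc)
  also have "\<dots> = (\<Sum>k\<le>n. gauss_binomial Q n k * ?c k * x ^ (Suc n - k))
      + (\<Sum>k\<le>n. Q ^ (n - k) * gauss_binomial Q n k * ?c (Suc k) * x ^ (n - k))"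
  proof -
    have "(\<Sum>k\<le>n. gauss_binomial Q n k * ?c k * x ^ (n - k)) * x
        = (\<Sum>k\<le>n. gauss_binomial Q n k * ?c k * x ^ (Suc n - k))"
      unfolding sum_distrib_right by (intro sum.cong refl) (simp add: Suc_diff_le mult_ac)
    moreover have "(\<Sum>k\<le>n. gauss_binomial Q n k * ?c k * x ^ (n - k)) * (y * Q ^ n)
        = (\<Sum>k\<le>n. Q ^ (n - k) * gauss_binomial Q n k * ?c (Suc k) * x ^ (n - k))"
      unfolding sum_distrib_right
    proof (intro sum.cong refl)
      fix k assume "k \<in> {..n}"
      then have "Q ^ n = Q ^ (n - k) * Q ^ k" by (simp flip: power_add)
      then show "gauss_binomial Q n k * ?c k * x ^ (n - k) * (y * Q ^ n)
          = Q ^ (n - k) * gauss_binomial Q n k * ?c (Suc k) * x ^ (n - k)"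
        by (simp add: choose2 power_add mult_ac)
    qed
    ultimately show ?thesis by (simp only: distrib_left)
  qed
  also have "(\<Sum>k\<le>n. gauss_binomial Q n k * ?c k * x ^ (Suc n - k))
      = (\<Sum>k\<le>Suc n. gauss_binomial Q n k * ?c k * x ^ (Suc n - k))"
    by (simp add: gauss_binomial_eq_0)
  also have "\<dots> = x ^ Suc n + (\<Sum>k\<le>n. gauss_binomial Q n (Suc k) * ?c (Suc k) * x ^ (n - k))"
    by (subst sum.atMost_Suc_shift) (simp add: numeral_2_eq_2)
  finally have "(\<Prod>i<Suc n. x + y * Q ^ i)
      = x ^ Suc n + (\<Sum>k\<le>n. gauss_binomial Q (Suc n) (Suc k) * ?c (Suc k) * x ^ (n - k))"
    by (simp add: sum.distrib[symmetric] algebra_simps)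
  also have "\<dots> = (\<Sum>k\<le>Suc n. gauss_binomial Q (Suc n) k * ?c k * x ^ (Suc n - k))"
    by (simp only: sum.atMost_Suc_shift[of _ n]) (simp add: numeral_2_eq_2)
  finally show ?case by (simp add: mult.assoc)
qed

lemma qpoch_cong:
  assumes "k \<le> n"
  shows "Q ^ Suc k dvd qpoch Q n - qpoch Q k"
  using assms
proof (induction rule: dec_induct)
  case base
  then show ?case by simp
next
  case (step m)
  have "Q ^ Suc k dvd Q ^ Suc m * qpoch Q m"
    using step by (intro dvd_mult2 le_imp_power_dvd) simp
  moreover have "qpoch Q (Suc m) - qpoch Q k = (qpoch Q m - qpoch Q k) - Q ^ Suc m * qpoch Q m"
    by (simp add: qpoch_def algebra_simps)
  ultimately show ?case using step by (metis dvd_diff)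
qed

text \<open>
  Let \<open>k = min i (2 * N - i)\<close>. All \<open>q\<close>-Pochhammer symbols with index at least \<open>k\<close> agree modulo
  \<open>Q ^ Suc k\<close> with the one of index \<open>k\<close>. The quotient formula for the Gaussian binomial coefficient \<open>g\<close>
  therefore becomes \<open>u * u * g = u\<close> modulo \<open>Q ^ Suc k\<close>, where \<open>u\<close> is that symbol, and cancelling the
  unit \<open>u\<close> gives the claim.
\<close>

lemma qpoch_mult_gauss_binomial_cong_1:
  assumes i: "i \<le> 2 * N" and unit: "is_unit (qpoch Q (min i (2 * N - i)))"
  shows "Q ^ Suc (min i (2 * N - i)) dvd qpoch Q N * gauss_binomial Q (2 * N) i - 1"
proof -
  define k where "k = min i (2 * N - i)"
  define u where "u = qpoch Q k"
  define g where "g = gauss_binomial Q (2 * N) i"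
  have k: "k \<le> i" "k \<le> 2 * N - i" "k \<le> N" "k \<le> 2 * N"
    using i by (auto simp: k_def)
  have prod: "u * qpoch Q (max i (2 * N - i)) * g = qpoch Q (2 * N)"
  proof (cases "i \<le> N")
    case True
    then have "min i (2 * N - i) = i" "max i (2 * N - i) = 2 * N - i" by auto
    then show ?thesis
      using qpoch_mult_gauss_binomial[OF i, of Q] by (simp only: u_def g_def k_def)
  next
    case False
    then have "min i (2 * N - i) = 2 * N - i" "max i (2 * N - i) = i" by auto
    then show ?thesis
      using qpoch_mult_gauss_binomial[OF i, of Q] by (simp only: u_def g_def k_def mult_ac)
  qed
  have 1: "Q ^ Suc k dvd qpoch Q (max i (2 * N - i)) - u"
    unfolding u_def using k by (intro qpoch_cong) simp
  have 2: "Q ^ Suc k dvd qpoch Q (2 * N) - u"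
    unfolding u_def using k by (intro qpoch_cong) simp
  have 3: "Q ^ Suc k dvd qpoch Q N - u"
    unfolding u_def using k by (intro qpoch_cong) simp
  have "u * (u * g - 1) = (qpoch Q (2 * N) - u) - u * g * (qpoch Q (max i (2 * N - i)) - u)"
    unfolding prod[symmetric] by (simp add: algebra_simps)
  then have "Q ^ Suc k dvd u * (u * g - 1)"
    using 1 2 by (metis dvd_diff dvd_mult)
  moreover obtain w where w: "1 = u * w"
    using unit unfolding u_def k_def by (elim dvdE)
  ultimately have "Q ^ Suc k dvd w * (u * (u * g - 1))" by (metis dvd_mult)
  also have "w * (u * (u * g - 1)) = (u * w) * (u * g - 1)" by (simp only: mult_ac)
  finally have "Q ^ Suc k dvd u * g - 1" by (simp only: w[symmetric] mult_1_left)
  moreover have "qpoch Q N * g - 1 = (u * g - 1) + g * (qpoch Q N - u)"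
    by (simp add: algebra_simps)
  ultimately have "Q ^ Suc k dvd qpoch Q N * g - 1"
    using 3 by (metis dvd_add dvd_mult)
  then show ?thesis by (simp add: k_def g_def)
qed

section \<open>The triple product\<close>

definition tri :: "int \<Rightarrow> nat" where
  "tri m = nat (m * (m + 1) div 2)"

lemma two_times_tri: "2 * int (tri m) = m * (m + 1)"
proof -
  have "0 \<le> m * (m + 1)"
    by (cases "m \<ge> 0") (auto intro: mult_nonpos_nonpos)
  moreover have "even (m * (m + 1))" by simp
  ultimately show ?thesis by (simp add: tri_def)
qed

text \<open>
  Written in Ramanujan's two variables \<open>a\<close> and \<open>b\<close> with \<open>Q = a * b\<close>, this is the \<open>q\<close>-binomial theorem for
  the \<open>2 * N\<close> factors \<open>Q ^ N + a * Q ^ i\<close>. The first half of them is \<open>a * Q ^ i * (1 + b * Q ^ (N - 1 - i))\<close>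
  and the second half is \<open>Q ^ N * (1 + a * Q ^ (i - N))\<close>, so both sides carry a common monomial in \<open>a\<close> and
  \<open>b\<close>. Once it is cancelled, the exponents on the right are triangular numbers in \<open>k - N\<close>.
\<close>

lemma finite_triple_product:
  fixes a b :: "'a::idom"
  assumes "a \<noteq> 0" and "b \<noteq> 0"
  shows "(\<Prod>i<N. (1 + a * (a * b) ^ i) * (1 + b * (a * b) ^ i))
       = (\<Sum>k\<le>2 * N. gauss_binomial (a * b) (2 * N) k
            * (a ^ tri (int k - int N) * b ^ tri (int N - int k)))"
proof -
  define Q where "Q = a * b"
  have choose2: "2 * int (k choose 2) = int k * (int k - 1)" for k
  proof (induction k)
    case (Suc k)
    have "Suc k choose 2 = k + (k choose 2)" by (simp add: numeral_2_eq_2)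
    then show ?case using Suc by (simp add: algebra_simps)
  qed simp
  \<comment> \<open>The common monomial is \<open>a ^ (N + D) * b ^ D\<close>.\<close>
  define D where "D = (N choose 2) + N * N"
  have split: "(\<Prod>i<m + n. f i) = (\<Prod>i<m. f i) * (\<Prod>i<n. f (m + i))" for f :: "nat \<Rightarrow> 'a" and m n
    by (induction n) (auto simp: mult_ac)
  have "(\<Prod>i<2 * N. Q ^ N + a * Q ^ i)
      = (\<Prod>i<N. Q ^ N + a * Q ^ i) * (\<Prod>i<N. Q ^ N + a * Q ^ (N + i))"
    using split[of "\<lambda>i. Q ^ N + a * Q ^ i" N N] by (simp add: mult_2)
  also have "(\<Prod>i<N. Q ^ N + a * Q ^ i) = (\<Prod>i<N. (a * Q ^ i) * (1 + b * Q ^ (N - Suc i)))"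
  proof (intro prod.cong refl)
    fix i assume "i \<in> {..<N}"
    then have "Q ^ N = Q ^ (Suc i + (N - Suc i))" by simp
    then have "Q ^ N = Q * Q ^ i * Q ^ (N - Suc i)" by (simp only: power_add power_Suc)
    then show "Q ^ N + a * Q ^ i = (a * Q ^ i) * (1 + b * Q ^ (N - Suc i))"
      by (simp add: Q_def algebra_simps)
  qed
  also have "\<dots> = (\<Prod>i<N. a * Q ^ i) * (\<Prod>i<N. 1 + b * Q ^ i)"
    by (simp only: prod.distrib prod.nat_diff_reindex[of "\<lambda>i. 1 + b * Q ^ i" N])
  also have "(\<Prod>i<N. Q ^ N + a * Q ^ (N + i)) = Q ^ (N * N) * (\<Prod>i<N. 1 + a * Q ^ i)"
  proof -
    have "(\<Prod>i<N. Q ^ N + a * Q ^ (N + i)) = (\<Prod>i<N. Q ^ N * (1 + a * Q ^ i))"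
      by (intro prod.cong refl) (simp add: power_add algebra_simps)
    then show ?thesis by (simp add: prod.distrib power_mult)
  qed
  also have "(\<Prod>i<N. a * Q ^ i) = a ^ N * Q ^ (N choose 2)"
    by (induction N) (auto simp: power_add numeral_2_eq_2 mult_ac)
  finally have lhs: "(\<Prod>i<2 * N. Q ^ N + a * Q ^ i)
      = (a ^ (N + D) * b ^ D) * (\<Prod>i<N. (1 + a * Q ^ i) * (1 + b * Q ^ i))"
    by (simp add: prod.distrib D_def power_add power_mult_distrib Q_def mult_ac)
  have exponents: "Q ^ (k choose 2) * a ^ k * (Q ^ N) ^ (2 * N - k)
      = (a ^ (N + D) * b ^ D) * (a ^ tri (int k - int N) * b ^ tri (int N - int k))"
    if "k \<le> 2 * N" for k
  proof -
    define l where "l = 2 * N - k"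
    have l: "int l = 2 * int N - int k" using that by (simp add: l_def)
    have a: "(k choose 2) + k + N * l = N + D + tri (int k - int N)"
      unfolding of_nat_eq_iff[where 'a = int, symmetric] D_def
      using choose2[of k] choose2[of N] two_times_tri[of "int k - int N"]
      by (simp add: l algebra_simps)
    have b: "(k choose 2) + N * l = D + tri (int N - int k)"
      unfolding of_nat_eq_iff[where 'a = int, symmetric] D_def
      using choose2[of k] choose2[of N] two_times_tri[of "int N - int k"]
      by (simp add: l algebra_simps)
    have "Q ^ (k choose 2) * a ^ k * (Q ^ N) ^ l
        = a ^ ((k choose 2) + k + N * l) * b ^ ((k choose 2) + N * l)"
      by (simp add: Q_def power_mult_distrib power_add power_mult mult_ac flip: l_def)
    also have "\<dots> = (a ^ (N + D) * b ^ D) * (a ^ tri (int k - int N) * b ^ tri (int N - int k))"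
      unfolding a b by (simp add: power_add mult_ac)
    finally show ?thesis by (simp only: l_def)
  qed
  have "(a ^ (N + D) * b ^ D) * (\<Prod>i<N. (1 + a * Q ^ i) * (1 + b * Q ^ i))
      = (\<Sum>k\<le>2 * N. gauss_binomial Q (2 * N) k * (Q ^ (k choose 2) * a ^ k * (Q ^ N) ^ (2 * N - k)))"
    using q_binomial_theorem[of "Q ^ N" a Q "2 * N"] lhs by (simp add: mult.assoc)
  also have "\<dots> = (a ^ (N + D) * b ^ D) * (\<Sum>k\<le>2 * N. gauss_binomial Q (2 * N) k
            * (a ^ tri (int k - int N) * b ^ tri (int N - int k)))"
    unfolding sum_distrib_left
  proof (intro sum.cong refl)
    fix k assume "k \<in> {..2 * N}"
    then have "k \<le> 2 * N" by simp
    show "gauss_binomial Q (2 * N) k * (Q ^ (k choose 2) * a ^ k * (Q ^ N) ^ (2 * N - k))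
        = a ^ (N + D) * b ^ D * (gauss_binomial Q (2 * N) k
            * (a ^ tri (int k - int N) * b ^ tri (int N - int k)))"
      unfolding exponents[OF \<open>k \<le> 2 * N\<close>] by (simp only: mult_ac)
  qed
  finally show ?thesis
    using assms by (simp add: Q_def)
qed

section \<open>The generating function of the generalized polygonal numbers\<close>

definition gonal_fps :: "nat \<Rightarrow> real fps" where
  "gonal_fps s = Abs_fps (\<lambda>n. real (card {m. gonal s m = int n}))"

text \<open>
  Splitting off the first entry of a tuple corresponds to the Cauchy product.
\<close>

lemma gonal_fps_power_nth:
  assumes "s \<ge> 3"
  shows "gonal_fps s ^ j $ n = real (gonal_reps s j n)"
proof (induction j arbitrary: n)
  case 0
  have "{ms. length ms = 0 \<and> (\<Sum>m\<leftarrow>ms. gonal s m) = int n} = (if n = 0 then {[]} else {})"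
    by auto
  then show ?case by (simp only: gonal_reps_def) simp
next
  case (Suc j)
  define A where "A = (\<lambda>i::nat. {m. gonal s m = int i})"
  define B where "B = (\<lambda>i::nat. {ms. length ms = j \<and> (\<Sum>m\<leftarrow>ms. gonal s m) = int i})"
  have A: "finite (A i)" for i
  proof (rule finite_subset)
    show "A i \<subseteq> {- (int i + 1)..int i + 1}"
    proof
      fix m assume "m \<in> A i"
      then show "m \<in> {- (int i + 1)..int i + 1}"
        using abs_le_gonal(1)[OF assms, of m] by (auto simp: A_def)
    qed
  qed simp
  have B: "finite (B i)" for i
    unfolding B_def by (rule finite_gonal_reps[OF assms])
  have "{ms. length ms = Suc j \<and> (\<Sum>m\<leftarrow>ms. gonal s m) = int n}
      = (\<lambda>(i, m, ms). m # ms) ` (SIGMA i:{0..n}. A i \<times> B (n - i))" (is "?L = ?R")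
  proof
    show "?L \<subseteq> ?R"
    proof
      fix xs assume "xs \<in> ?L"
      then obtain m ms where xs: "xs = m # ms" and len: "length ms = j"
        and sum: "gonal s m + (\<Sum>m\<leftarrow>ms. gonal s m) = int n"
        by (cases xs) auto
      have "0 \<le> (\<Sum>m\<leftarrow>ms. gonal s m)"
        by (rule sum_list_nonneg) (use abs_le_gonal(2)[OF assms] in auto)
      then have "(nat (gonal s m), m, ms) \<in> (SIGMA i:{0..n}. A i \<times> B (n - i))"
        using sum len abs_le_gonal(2)[OF assms, of m]
        by (auto simp: A_def B_def of_nat_diff)
      then show "xs \<in> ?R" unfolding xs by force
    qed
    show "?R \<subseteq> ?L" by (auto simp: A_def B_def)
  qed
  moreover have "inj_on (\<lambda>(i, m, ms). m # ms) (SIGMA i:{0..n}. A i \<times> B (n - i))"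
    by (auto simp: inj_on_def A_def)
  ultimately have "gonal_reps s (Suc j) n = card (SIGMA i:{0..n}. A i \<times> B (n - i))"
    unfolding gonal_reps_def by (simp only: card_image)
  also have "\<dots> = (\<Sum>i = 0..n. card (A i) * card (B (n - i)))"
    using A B by (simp add: card_SigmaI card_cartesian_product)
  finally have "real (gonal_reps s (Suc j) n) = (\<Sum>i = 0..n. real (card (A i)) * real (card (B (n - i))))"
    by simp
  also have "\<dots> = (\<Sum>i = 0..n. gonal_fps s $ i * (gonal_fps s ^ j $ (n - i)))"
    unfolding Suc gonal_reps_def by (simp add: gonal_fps_def A_def B_def)
  finally show ?case
    by (simp add: fps_mult_nth)
qed

text \<open>
  This identifies the terms of the triple product at \<open>a = q\<close> and \<open>b = q ^ (s - 3)\<close>, where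
  \<open>a * b = q ^ (s - 2)\<close>, as the terms of the generating function.
\<close>

lemma gonal_eq_tri:
  assumes "s \<ge> 3"
  shows "gonal s m = int (tri m + (s - 3) * tri (- m))"
proof -
  have s: "int (s - 3) = int s - 3" using assms by simp
  have "2 * int (tri m + (s - 3) * tri (- m)) = 2 * int (tri m) + int (s - 3) * (2 * int (tri (- m)))"
    by simp
  also have "\<dots> = 2 * gonal s m"
    unfolding two_times_gonal two_times_tri s by (simp add: algebra_simps power2_eq_square)
  finally show ?thesis by simp
qed

text \<open>
  After multiplication by the \<open>q\<close>-Pochhammer symbol, the term with index \<open>k = N + m\<close> of the finite triple
  product differs from \<open>q ^ F\<^sub>s m\<close> by a series of order at least \<open>v * (N - \<bar>m\<bar> + 1) + F\<^sub>s m\<close>. As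
  \<open>F\<^sub>s m \<ge> \<bar>m\<bar> - 1\<close> and \<open>v \<ge> 1\<close>, this order is at least \<open>N\<close>, so the difference does not affect the coefficients below degree \<open>N\<close>. The same bound shows that every \<open>m\<close> with \<open>F\<^sub>s m < N\<close>
  occurs in the range \<open>\<bar>m\<bar> \<le> N\<close> of the finite sum.
\<close>

lemma gonal_fps_nth_triple_product:
  fixes s N n :: nat
  assumes s: "s \<ge> 4" and n: "n < N"
  defines "v \<equiv> s - 2"
  shows "gonal_fps s $ n = (qpoch (fps_X ^ v) N *
     (\<Prod>i<N. (1 + fps_X ^ (v * i + 1)) * (1 + fps_X ^ (v * i + (v - 1))))) $ n"
proof -
  define Q :: "real fps" where "Q = fps_X ^ v"
  define F where "F = (\<lambda>k. nat (gonal s (int k - int N)))"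
  have v: "v \<ge> 2" and v1: "v - 1 = s - 3" using s by (auto simp: v_def)
  have Q: "fps_X * fps_X ^ (v - 1) = Q"
    using v by (simp add: Q_def flip: power_Suc)
  have gF: "gonal s (int k - int N) = int (F k)" for k
    using abs_le_gonal(2)[of s] s by (simp add: F_def)
  have F: "F k = tri (int k - int N) + (s - 3) * tri (int N - int k)" for k
    using gonal_eq_tri[of s "int k - int N"] s unfolding gF of_nat_eq_iff by simp
  have "(\<Prod>i<N. (1 + fps_X ^ (v * i + 1)) * (1 + fps_X ^ (v * i + (v - 1))))
      = (\<Prod>i<N. (1 + fps_X * Q ^ i) * (1 + fps_X ^ (v - 1) * Q ^ i))"
    by (simp add: Q_def power_add mult_ac flip: power_mult)
  also have "\<dots> = (\<Sum>k\<le>2 * N. gauss_binomial Q (2 * N) k * fps_X ^ F k)"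
    using finite_triple_product[of "fps_X :: real fps" "fps_X ^ (v - 1)" N]
    by (simp only: Q) (simp only: F power_add power_mult flip: v1, simp)
  finally have prod: "(\<Prod>i<N. (1 + fps_X ^ (v * i + 1)) * (1 + fps_X ^ (v * i + (v - 1))))
      = (\<Sum>k\<le>2 * N. gauss_binomial Q (2 * N) k * fps_X ^ F k)" .
  have small: "(qpoch Q N * gauss_binomial Q (2 * N) k * fps_X ^ F k) $ n = (fps_X ^ F k :: real fps) $ n"
    if k: "k \<le> 2 * N" for k
  proof -
    define r where "r = min k (2 * N - k)"
    have "qpoch Q r $ 0 = 1"
      using v by (simp add: qpoch_def Q_def fps_prod_nth_0 flip: power_mult power_add power_Suc)
    then have "is_unit (qpoch Q r)" by (simp add: fps_is_unit_iff)
    then have "Q ^ Suc r dvd qpoch Q N * gauss_binomial Q (2 * N) k - 1"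
      using qpoch_mult_gauss_binomial_cong_1[OF k, of Q] by (simp only: r_def)
    then obtain h where h: "qpoch Q N * gauss_binomial Q (2 * N) k - 1 = Q ^ Suc r * h" ..
    have "qpoch Q N * gauss_binomial Q (2 * N) k * fps_X ^ F k
        = fps_X ^ F k + fps_X ^ (v * Suc r + F k) * h"
    proof -
      have "qpoch Q N * gauss_binomial Q (2 * N) k = 1 + fps_X ^ (v * Suc r) * h"
        using h unfolding power_mult Q_def[symmetric] by (simp only: diff_eq_eq add.commute)
      then show ?thesis by (simp add: power_add algebra_simps)
    qed
    moreover have "n < v * Suc r + F k"
    proof -
      have "int r = int N - \<bar>int k - int N\<bar>" using k by (auto simp: r_def min_def)
      moreover have "\<bar>int k - int N\<bar> \<le> int (F k) + 1"
        using abs_le_gonal(1)[of s "int k - int N"] s by (simp add: gF)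
      ultimately have "N \<le> Suc r + F k" by linarith
      also have "Suc r \<le> v * Suc r" using v by (metis mult_le_mono1 mult_1 one_le_numeral order_trans)
      finally show ?thesis using n by simp
    qed
    ultimately show ?thesis by (simp add: fps_X_power_mult_nth)
  qed
  have "(qpoch Q N * (\<Sum>k\<le>2 * N. gauss_binomial Q (2 * N) k * fps_X ^ F k)) $ n
      = (\<Sum>k\<le>2 * N. (fps_X ^ F k :: real fps) $ n)"
    by (simp add: sum_distrib_left fps_sum_nth small flip: mult.assoc)
  also have "\<dots> = (\<Sum>k\<le>2 * N. if F k = n then 1 else 0)"
    by (intro sum.cong) auto
  also have "\<dots> = real (card {k \<in> {..2 * N}. F k = n})"
    by (simp add: sum.If_cases Int_def)
  also have "card {k \<in> {..2 * N}. F k = n} = card {m. gonal s m = int n}"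
  proof (rule bij_betw_same_card)
    show "bij_betw (\<lambda>k. int k - int N) {k \<in> {..2 * N}. F k = n} {m. gonal s m = int n}"
    proof (rule bij_betw_byWitness[where f' = "\<lambda>m. nat (m + int N)"])
      show "(\<lambda>m. nat (m + int N)) ` {m. gonal s m = int n} \<subseteq> {k \<in> {..2 * N}. F k = n}"
      proof (rule image_subsetI)
        fix m assume "m \<in> {m. gonal s m = int n}"
        then have m: "gonal s m = int n" by simp
        then have "\<bar>m\<bar> \<le> int N" using abs_le_gonal(1)[of s m] s n by linarith
        then show "nat (m + int N) \<in> {k \<in> {..2 * N}. F k = n}"
          using m by (auto simp: F_def)
      qed
      show "\<forall>m\<in>{m. gonal s m = int n}. int (nat (m + int N)) - int N = m"
      proof
        fix m assume "m \<in> {m. gonal s m = int n}"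
        then have "\<bar>m\<bar> \<le> int N" using abs_le_gonal(1)[of s m] s n by simp
        then show "int (nat (m + int N)) - int N = m" by simp
      qed
    qed (auto simp: gF)
  qed
  finally show ?thesis
    unfolding prod Q_def[symmetric] by (simp add: gonal_fps_def)
qed

section \<open>The logarithmic coefficients as divisor sums\<close>

lemma sum_dividing_exponents:
  fixes h :: "nat \<Rightarrow> real"
  assumes "finite I" and "n \<ge> 1"
  shows "(\<Sum>i\<in>I. if e i dvd n then h (n div e i) else 0)
       = (\<Sum>d | d dvd n. h d * real (card {i\<in>I. e i = n div d}))"
proof -
  have fin: "finite {d. d dvd n}" using assms by simp
  have inner: "(\<Sum>d | d dvd n. if e i = n div d then h d else 0)
      = (if e i dvd n then h (n div e i) else 0)" for i
  proof -
    have "(\<Sum>d | d dvd n. if e i = n div d then h d else 0)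
        = (\<Sum>d | d dvd n. if d = n div e i \<and> e i dvd n then h d else 0)"
      using assms by (intro sum.cong) (auto elim!: dvdE)
    also have "\<dots> = (if e i dvd n then h (n div e i) else 0)"
    proof (cases "e i dvd n")
      case True
      then have "n div e i dvd n" by (metis dvd_div_mult_self dvd_triv_left)
      then show ?thesis using True fin by (simp add: sum.delta)
    qed simp
    finally show ?thesis .
  qed
  have "(\<Sum>d | d dvd n. h d * real (card {i\<in>I. e i = n div d}))
      = (\<Sum>d | d dvd n. \<Sum>i\<in>I. if e i = n div d then h d else 0)"
    using assms(1) by (simp add: sum.If_cases Int_def mult.commute)
  also have "\<dots> = (\<Sum>i\<in>I. \<Sum>d | d dvd n. if e i = n div d then h d else 0)"
    by (rule sum.swap)
  finally show ?thesis by (simp only: inner)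
qed

lemma fps_log_prod_binomials_nth:
  assumes n: "n \<ge> 1" and I: "finite I" and e: "\<And>i. i \<in> I \<Longrightarrow> e i \<ge> 1"
  shows "fps_log (\<Prod>i\<in>I. 1 + fps_const c * fps_X ^ e i) $ n
       = - (\<Sum>d | d dvd n. (- c) ^ d / real d * real (card {i\<in>I. e i = n div d}))"
proof -
  have "fps_log (\<Prod>i\<in>I. 1 + fps_const c * fps_X ^ e i) = (\<Sum>i\<in>I. fps_log (1 + fps_const c * fps_X ^ e i))"
    using fps_log_prod[OF I, of "\<lambda>i. 1 + fps_const c * fps_X ^ e i"] e by (fastforce simp: Suc_le_eq)
  then have "fps_log (\<Prod>i\<in>I. 1 + fps_const c * fps_X ^ e i) $ n
      = (\<Sum>i\<in>I. if e i dvd n then - ((- c) ^ (n div e i) / real (n div e i)) else 0)"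
    using n e by (auto simp: fps_sum_nth fps_log_binomial_nth intro!: sum.cong)
  also have "\<dots> = (\<Sum>d | d dvd n. - ((- c) ^ d / real d) * real (card {i\<in>I. e i = n div d}))"
    by (rule sum_dividing_exponents[OF I n])
  finally show ?thesis by (simp add: sum_negf)
qed

lemma card_residue_class:
  fixes v r m N :: nat
  assumes "r < v"
  shows "card {i. i < N \<and> v * i + r = m} = (if m mod v = r \<and> m div v < N then 1 else 0)"
proof -
  have "v * i + r = m \<longleftrightarrow> i = m div v \<and> m mod v = r" for i
    using assms by auto
  then have "{i. i < N \<and> v * i + r = m} = (if m mod v = r \<and> m div v < N then {m div v} else {})"
    by auto
  then show ?thesis by simp
qed

text \<open>
  For \<open>v = 2\<close> the residues \<open>1\<close> and \<open>v - 1\<close> coincide, and the odd numbers are counted once by each family.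
\<close>

lemma delta1_eq_card:
  assumes v: "v \<ge> 2" and m: "1 \<le> m" "m \<le> N"
  shows "delta1 m v
    = card {i\<in>{..<N}. v * i + 1 = m} + card {i\<in>{..<N}. v * i + (v - 1) = m}"
proof -
  have "m div v < m" using v m by simp
  then have "m div v < N" using m by simp
  then have "card {i\<in>{..<N}. v * i + 1 = m} = (if m mod v = 1 then 1 else 0)"
    and "card {i\<in>{..<N}. v * i + (v - 1) = m} = (if m mod v = v - 1 then 1 else 0)"
    using card_residue_class[of 1 v N m] card_residue_class[of "v - 1" v N m] assms by auto
  then show ?thesis
    using v by (cases "v = 2") (auto simp: delta1_def cong_def)
qed

lemma delta2_eq_card:
  assumes v: "v \<ge> 2" and m: "1 \<le> m" "m \<le> N"
  shows "delta2 m v = card {i\<in>{..<N}. v * Suc i = m}"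
proof -
  have "{i\<in>{..<N}. v * Suc i = m} = (if v dvd m then {m div v - 1} else {})"
  proof (cases "v dvd m")
    case True
    then obtain k where k: "m = v * k" ..
    then obtain j where j: "k = Suc j" using m by (cases k) auto
    have "k \<le> m" using k v by simp
    then show ?thesis using k j m v by auto
  qed auto
  then show ?thesis by (simp add: delta2_def cong_def dvd_eq_mod_eq_0)
qed

section \<open>Comparing the two expressions for the logarithmic coefficient\<close>

theorem theorem2p3:
  fixes n s :: nat
  assumes "n \<ge> 1" and "s \<ge> 4"
  shows "(\<Sum>d | d dvd n. 1 / real d *
            ((-1) ^ d * real (delta1 (n div d) (s - 2)) + real (delta2 (n div d) (s - 2))))
       = (\<Sum>j = 1..n. (-1) ^ j / real j * real (n choose j) * real (gonal_reps s j n))"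
proof -
  define v where "v = s - 2"
  \<comment> \<open>Only degrees up to \<open>n\<close> matter, so more than \<open>n\<close> factors of each family suffice.\<close>
  define N where "N = Suc n"
  have v: "v \<ge> 2" using assms by (simp add: v_def)
  let ?P = "\<lambda>c e. \<Prod>i<N. 1 + fps_const c * fps_X ^ e i :: real fps"
  \<comment> \<open>The triple product truncated to \<open>N\<close> factors of each family.\<close>
  let ?H = "?P (-1) (\<lambda>i. v * Suc i) * (?P 1 (\<lambda>i. v * i + 1) * ?P 1 (\<lambda>i. v * i + (v - 1)))"
  have pos: "v * Suc i \<ge> 1" "v * i + 1 \<ge> 1" "v * i + (v - 1) \<ge> 1" for i
    using v by auto
  have P0: "?P c e $ 0 = 1" if "\<And>i. e i \<ge> 1" for c and e :: "nat \<Rightarrow> nat"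
  proof -
    have e0: "e i \<noteq> 0" for i using that[of i] by simp
    show ?thesis by (simp add: fps_prod_nth_0 e0)
  qed
  have P: "fps_log (?P c e) $ n
      = - (\<Sum>d | d dvd n. (- c) ^ d / real d * real (card {i\<in>{..<N}. e i = n div d}))"
    if "\<And>i. e i \<ge> 1" for c and e :: "nat \<Rightarrow> nat"
    using assms that by (intro fps_log_prod_binomials_nth) auto
  have H: "gonal_fps s $ m = ?H $ m" if "m \<le> n" for m
  proof -
    have eq: "?H = qpoch (fps_X ^ v) N *
     (\<Prod>i<N. (1 + fps_X ^ (v * i + 1)) * (1 + fps_X ^ (v * i + (v - 1))))"
    proof -
      have "1 + fps_const (-1) * fps_X ^ (v * Suc i) = 1 - (fps_X ^ v :: real fps) ^ Suc i" for i
        unfolding power_mult by (simp add: fps_const_neg[symmetric] del: fps_const_neg power_Suc)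
      then show ?thesis
        by (simp only: qpoch_def prod.distrib fps_const_1_eq_1 mult_1_left)
    qed
    show ?thesis
      unfolding eq unfolding v_def
      by (rule gonal_fps_nth_triple_product) (use that assms in \<open>simp_all add: N_def\<close>)
  qed
  have "(\<Sum>j = 1..n. (-1) ^ j / real j * real (n choose j) * real (gonal_reps s j n))
      = - (fps_log (gonal_fps s) $ n)"
    using assms by (simp add: fps_log_nth_powers gonal_fps_power_nth)
  also have "fps_log (gonal_fps s) $ n = fps_log ?H $ n"
    using H by (rule fps_log_nth_cong)
  also have "- \<dots> = (\<Sum>d | d dvd n. 1 / real d *
            ((-1) ^ d * real (delta1 (n div d) v) + real (delta2 (n div d) v)))"
  proof -
    have "fps_log ?H $ n = fps_log (?P (-1) (\<lambda>i. v * Suc i)) $ n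
        + (fps_log (?P 1 (\<lambda>i. v * i + 1)) $ n + fps_log (?P 1 (\<lambda>i. v * i + (v - 1))) $ n)"
      by (simp only: fps_log_mult P0[OF pos(1)] P0[OF pos(2)] P0[OF pos(3)]
          fps_mult_nth_0 mult_1_left fps_add_nth)
    also have "\<dots> = - (\<Sum>d | d dvd n. 1 / real d *
            ((-1) ^ d * real (delta1 (n div d) v) + real (delta2 (n div d) v)))"
    proof -
      have "1 / real d * ((-1) ^ d * real (delta1 (n div d) v) + real (delta2 (n div d) v))
          = 1 / real d * real (card {i\<in>{..<N}. v * Suc i = n div d})
            + (-1) ^ d / real d * real (card {i\<in>{..<N}. v * i + 1 = n div d})
            + (-1) ^ d / real d * real (card {i\<in>{..<N}. v * i + (v - 1) = n div d})"
        if "d dvd n" for d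
      proof -
        have "n div d \<le> N"
          by (simp add: N_def le_SucI)
        moreover have "1 \<le> n div d"
          using that assms by (auto elim!: dvdE)
        ultimately show ?thesis
          by (simp add: delta1_eq_card[OF v] delta2_eq_card[OF v] distrib_left add_ac)
      qed
      then show ?thesis
        by (simp only: P[OF pos(1)] P[OF pos(2)] P[OF pos(3)]) (simp add: sum.distrib)
    qed
    finally show ?thesis by simp
  qed
  finally show ?thesis by (simp add: v_def)
qed

end
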